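(* Let $G$ be a group, let $X$ be a (right) $G$-set with $G\cap X=\emptyset$, and let $0$ be a symbol with $0\notin G\cup X$. Then the $G$-set $X$ is congruence permutable if and only if the semigroup $(G,X,0)$ is segregated, has at most two orbit subsemigroups, and every orbit subsemigroup of $(G,X,0)$ is congruence permutable.
   Context: Let $G$ be a group with identity $e$. A $G$-set is a right $G$-set: a non-empty set $X$ together with a map $X\times G\to X$, $(x,g)\mapsto x^g$, satisfying $x^e=x$ and $(x^g)^h=x^{(gh)}$ for all $x\in X$, $g,h\in G$. A $G$-set $X$ is transitive if for all $x,y\in X$ there is $g\in G$ with $x^g=y$. An orbit of $X$ is a transitive $G$-subset of $X$; $X$ is the disjoint union of its orbits. A congruence of a $G$-set $X$ is an equivalence relation $\sigma$ on $X$ such that $(a,b)\in\sigma$ implies $(a^g,b^g)\in\sigma$ for every $g\in G$. A congruence on a semigroup $(S,* )$ is an equivalence relation $\alpha$ on $S$ such that $(a,b)\in\alpha$ implies $(s*a,s*b)\in\alpha$ and $(a*s,b*s)\in\alpha$ for every $s\in S$. An algebraic structure (a $G$-set or a semigroup) is congruence permutable if $\alpha\circ\beta=\beta\circ\alpha$ for all its congruences $\alpha,\beta$, where $\circ$ is the usual composition of binary relations. The semigroup $(G,X,0)$: for a right $G$-set $X$ with $G\cap X=\emptyset$ and a symbol $0\notin G\cup X$, it is the set $S=G\cup X\cup\{0\}$ with the operation $*$ defined by: $g*h=gh$ (product in $G$) for $g,h\in G$; $x*g=x^g$ for $x\in X$, $g\in G$; $0*g=0$ for $g\in G$; and $s*a=0$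 for all $s\in S$ and all $a\in X\cup\{0\}$. This is a semigroup with zero element $0$. A $G$-set $X$ is called segregated if every congruence $\alpha$ of the $G$-set $X$ satisfies: if $A$ and $B$ are different orbits of $X$ such that $(a_0,b_0)\in\alpha$ for some $a_0\in A$ and $b_0\in B$, then $(a,b)\in\alpha$ for all $a,b\in A\cup B$. The semigroup $(G,X,0)$ is called segregated if the $G$-set $X$ is segregated. For an orbit $A$ of the $G$-set $X$, the subsemigroup $(G,A,0)=G\cup A\cup\{0\}$ of $(G,X,0)$ is called an orbit subsemigroup of $(G,X,0)$. *)

theory Defs
  imports "HOL-Algebra.Group"
begin

text \<open>The actions of \<open>HOL-Algebra.Group_Action\<close> are left actions; here groups act on the right,
  and \<open>act x g\<close> stands for \<open>x\<close> to the power \<open>g\<close>. A \<open>G\<close>-set is non-empty.\<close>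

locale right_gset = group G for G (structure) +
  fixes X :: "'x set" and act :: "'x \<Rightarrow> 'a \<Rightarrow> 'x"
  assumes nonempty: "X \<noteq> {}"
    and act_closed: "\<lbrakk>x \<in> X; g \<in> carrier G\<rbrakk> \<Longrightarrow> act x g \<in> X"
    and act_one: "x \<in> X \<Longrightarrow> act x \<one> = x"
    and act_mult: "\<lbrakk>x \<in> X; g \<in> carrier G; h \<in> carrier G\<rbrakk> \<Longrightarrow> act (act x g) h = act x (g \<otimes> h)"

definition gset_transitive :: "('a, 'm) monoid_scheme \<Rightarrow> 'x set \<Rightarrow> ('x \<Rightarrow> 'a \<Rightarrow> 'x) \<Rightarrow> bool" where
  "gset_transitive G X act \<longleftrightarrow> (\<forall>x\<in>X. \<forall>y\<in>X. \<exists>g\<in>carrier G. act x g = y)"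

definition gset_orbit :: "('a, 'm) monoid_scheme \<Rightarrow> 'x set \<Rightarrow> ('x \<Rightarrow> 'a \<Rightarrow> 'x) \<Rightarrow> 'x set \<Rightarrow> bool" where
  "gset_orbit G X act A \<longleftrightarrow> A \<subseteq> X \<and> right_gset G A act \<and> gset_transitive G A act"

definition gset_congruence ::
    "('a, 'm) monoid_scheme \<Rightarrow> 'x set \<Rightarrow> ('x \<Rightarrow> 'a \<Rightarrow> 'x) \<Rightarrow> ('x \<times> 'x) set \<Rightarrow> bool" where
  "gset_congruence G X act \<sigma> \<longleftrightarrow>
     equiv X \<sigma> \<and> (\<forall>(a, b)\<in>\<sigma>. \<forall>g\<in>carrier G. (act a g, act b g) \<in> \<sigma>)"

definition gset_congruence_permutable ::
    "('a, 'm) monoid_scheme \<Rightarrow> 'x set \<Rightarrow> ('x \<Rightarrow> 'a \<Rightarrow> 'x) \<Rightarrow> bool" where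
  "gset_congruence_permutable G X act \<longleftrightarrow>
     (\<forall>\<alpha> \<beta>. gset_congruence G X act \<alpha> \<and> gset_congruence G X act \<beta> \<longrightarrow> \<alpha> O \<beta> = \<beta> O \<alpha>)"

definition gset_segregated :: "('a, 'm) monoid_scheme \<Rightarrow> 'x set \<Rightarrow> ('x \<Rightarrow> 'a \<Rightarrow> 'x) \<Rightarrow> bool" where
  "gset_segregated G X act \<longleftrightarrow>
     (\<forall>\<alpha>. gset_congruence G X act \<alpha> \<longrightarrow>
       (\<forall>A B. gset_orbit G X act A \<and> gset_orbit G X act B \<and> A \<noteq> B \<and>
              (\<exists>a0\<in>A. \<exists>b0\<in>B. (a0, b0) \<in> \<alpha>) \<longrightarrow>
              (\<forall>a\<in>A \<union> B. \<forall>b\<in>A \<union> B. (a, b) \<in> \<alpha>)))"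


text \<open>Semigroups are given by a carrier set and an operation; a subsemigroup is a closed subset
  with the same operation.\<close>

locale semigroup_on =
  fixes S :: "'s set" and f :: "'s \<Rightarrow> 's \<Rightarrow> 's"
  assumes closed: "\<lbrakk>a \<in> S; b \<in> S\<rbrakk> \<Longrightarrow> f a b \<in> S"
    and assoc: "\<lbrakk>a \<in> S; b \<in> S; c \<in> S\<rbrakk> \<Longrightarrow> f (f a b) c = f a (f b c)"

definition semigroup_congruence :: "'s set \<Rightarrow> ('s \<Rightarrow> 's \<Rightarrow> 's) \<Rightarrow> ('s \<times> 's) set \<Rightarrow> bool" where
  "semigroup_congruence S f \<alpha> \<longleftrightarrow>
     equiv S \<alpha> \<and> (\<forall>(a, b)\<in>\<alpha>. \<forall>s\<in>S. (f s a, f s b) \<in> \<alpha> \<and> (f a s, f b s) \<in> \<alpha>)"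

definition semigroup_congruence_permutable :: "'s set \<Rightarrow> ('s \<Rightarrow> 's \<Rightarrow> 's) \<Rightarrow> bool" where
  "semigroup_congruence_permutable S f \<longleftrightarrow>
     (\<forall>\<alpha> \<beta>. semigroup_congruence S f \<alpha> \<and> semigroup_congruence S f \<beta> \<longrightarrow> \<alpha> O \<beta> = \<beta> O \<alpha>)"


text \<open>The semigroup \<open>(G, X, 0)\<close>, with \<open>z\<close> in the role of \<open>0\<close>. The group, the \<open>G\<close>-set and
  the zero live in one ambient type, so that their disjointness is an explicit hypothesis.
  Outside \<open>gx0_carrier G X z\<close> the value of \<open>gx0_mult\<close> is irrelevant.\<close>

definition gx0_carrier :: "('a, 'm) monoid_scheme \<Rightarrow> 'a set \<Rightarrow> 'a \<Rightarrow> 'a set" where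
  "gx0_carrier G X z = carrier G \<union> X \<union> {z}"

definition gx0_mult ::
    "('a, 'm) monoid_scheme \<Rightarrow> 'a set \<Rightarrow> ('a \<Rightarrow> 'a \<Rightarrow> 'a) \<Rightarrow> 'a \<Rightarrow> 'a \<Rightarrow> 'a \<Rightarrow> 'a" where
  "gx0_mult G X act z s t =
     (if s \<in> carrier G \<and> t \<in> carrier G then s \<otimes>\<^bsub>G\<^esub> t
      else if s \<in> X \<and> t \<in> carrier G then act s t
      else z)"

definition gx0_segregated ::
    "('a, 'm) monoid_scheme \<Rightarrow> 'a set \<Rightarrow> ('a \<Rightarrow> 'a \<Rightarrow> 'a) \<Rightarrow> 'a \<Rightarrow> bool" where
  "gx0_segregated G X act z \<longleftrightarrow> gset_segregated G X act"

text \<open>The carriers of the orbit subsemigroups; their operation is the one of \<open>(G, X, 0)\<close>.\<close>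

definition orbit_subsemigroups ::
    "('a, 'm) monoid_scheme \<Rightarrow> 'a set \<Rightarrow> ('a \<Rightarrow> 'a \<Rightarrow> 'a) \<Rightarrow> 'a \<Rightarrow> 'a set set" where
  "orbit_subsemigroups G X act z = {gx0_carrier G A z |A. gset_orbit G X act A}"

lemma semigroup_on_gx0:
  assumes "right_gset G X act" "carrier G \<inter> X = {}" "z \<notin> carrier G \<union> X"
  shows "semigroup_on (gx0_carrier G X z) (gx0_mult G X act z)"
proof -
  interpret right_gset G X act by fact
  have disj: "x \<notin> carrier G" if "x \<in> X" for x
    using assms(2) that by blast
  have zero: "z \<notin> carrier G" "z \<notin> X"
    using assms(3) by auto
  show ?thesis
  proof
    fix a b assume "a \<in> gx0_carrier G X z" "b \<in> gx0_carrier G X z"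
    then show "gx0_mult G X act z a b \<in> gx0_carrier G X z"
      by (simp add: gx0_carrier_def gx0_mult_def act_closed)
  next
    fix a b c
    assume "a \<in> gx0_carrier G X z" "b \<in> gx0_carrier G X z" "c \<in> gx0_carrier G X z"
    then have "a \<in> carrier G \<or> a \<in> X \<or> a = z" "b \<in> carrier G \<or> b \<in> X \<or> b = z"
      "c \<in> carrier G \<or> c \<in> X \<or> c = z"
      by (auto simp: gx0_carrier_def)
    then show "gx0_mult G X act z (gx0_mult G X act z a b) c =
        gx0_mult G X act z a (gx0_mult G X act z b c)"
      by (elim disjE)
        (simp_all add: gx0_mult_def act_closed act_mult m_assoc disj zero)
  qed
qed

lemma gx0_mult_orbit:
  assumes "gset_orbit G X act A" "carrier G \<inter> X = {}" "z \<notin> carrier G \<union> X"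
    and "s \<in> gx0_carrier G A z" "t \<in> gx0_carrier G A z"
  shows "gx0_mult G X act z s t = gx0_mult G A act z s t"
  using assms by (auto simp: gset_orbit_def gx0_carrier_def gx0_mult_def)

lemma semigroup_on_orbit_subsemigroup:
  assumes "carrier G \<inter> X = {}" "z \<notin> carrier G \<union> X" "T \<in> orbit_subsemigroups G X act z"
  shows "T \<subseteq> gx0_carrier G X z \<and> semigroup_on T (gx0_mult G X act z)"
proof -
  obtain A where A: "gset_orbit G X act A" and T: "T = gx0_carrier G A z"
    using assms(3) by (auto simp: orbit_subsemigroups_def)
  have sub: "A \<subseteq> X" and "right_gset G A act"
    using A by (auto simp: gset_orbit_def)
  then interpret A: semigroup_on T "gx0_mult G A act z"
    unfolding T using assms(1,2) by (intro semigroup_on_gx0) auto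
  have eq: "gx0_mult G X act z s t = gx0_mult G A act z s t" if "s \<in> T" "t \<in> T" for s t
    using gx0_mult_orbit[OF A assms(1,2)] that by (simp add: T)
  have "semigroup_on T (gx0_mult G X act z)"
    by unfold_locales (simp_all add: eq A.closed A.assoc)
  then show ?thesis
    using sub by (auto simp: T gx0_carrier_def)
qed

end

theory Submission
  imports Defs
begin

text \<open>
  Every invariant subset \<open>C\<close> of \<open>X\<close> gives a congruence \<open>C \<times> C \<union> Id\<close> that collapses \<open>C\<close> to a
  point and fixes everything else. Commuting an arbitrary congruence \<open>\<alpha>\<close> with the collapse of an
  orbit \<open>A\<close> shows that a link of \<open>\<alpha>\<close> from \<open>A\<close> to a point outside \<open>A\<close> spreads over all of \<open>A\<close>;
  doing this from both ends of a link between two orbits gives segregation. For three orbits \<open>A\<close>, \<open>B\<close>, \<open>C\<close>, the collapses of \<open>A \<union> B\<close> and \<open>B \<union> C\<close> do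
  not commute, because \<open>A\<close> reaches \<open>C\<close> through \<open>B\<close> in one order only. Conversely, if there are at
  most two orbits and \<open>X\<close> is segregated, then a congruence that joins different orbits is the full
  relation, which commutes with everything, and two congruences that stay inside the orbits commute
  as soon as their restrictions to the orbits do.

  It remains to compare an orbit \<open>A\<close> with its semigroup \<open>(G, A, 0)\<close>: one is congruence permutable
  iff the other is (\<open>semigroup_permutable_iff_gset_permutable\<close>). A congruence of the \<open>G\<close>-set \<open>A\<close>
  extends to the semigroup by the identity. In the other direction a congruence of the
  semigroup that joins \<open>G\<close> to its complement is the full relation, and one that joins a point of
  \<open>A\<close> to \<open>0\<close> collapses \<open>A \<union> {0}\<close>, as \<open>A\<close> is transitive. What is left is a pair consisting of a
  congruence of the group \<open>G\<close>, where permutability is automatic, and one of the \<open>G\<close>-set \<open>A\<close>.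
\<close>

section \<open>Commuting equivalence relations\<close>

lemma equivD:
  assumes "equiv X \<alpha>"
  shows "(x, y) \<in> \<alpha> \<Longrightarrow> x \<in> X" "(x, y) \<in> \<alpha> \<Longrightarrow> y \<in> X" "x \<in> X \<Longrightarrow> (x, x) \<in> \<alpha>"
    "(x, y) \<in> \<alpha> \<Longrightarrow> (y, x) \<in> \<alpha>" "\<lbrakk>(x, y) \<in> \<alpha>; (y, w) \<in> \<alpha>\<rbrakk> \<Longrightarrow> (x, w) \<in> \<alpha>"
  using equivE[OF assms] by (auto simp: refl_on_def dest: symD transD)

lemma equiv_extend_Id_on:
  assumes "equiv Y \<alpha>" "Y \<subseteq> X"
  shows "equiv X (\<alpha> \<union> Id_on X)"
proof (rule equivI)
  show "\<alpha> \<union> Id_on X \<subseteq> X \<times> X"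
    using assms(2) equivD(1,2)[OF assms(1)] by auto
  show "refl_on X (\<alpha> \<union> Id_on X)"
    by (auto simp: refl_on_def)
  show "sym (\<alpha> \<union> Id_on X)"
    by (rule symI) (auto intro: equivD(4)[OF assms(1)])
  show "trans (\<alpha> \<union> Id_on X)"
    by (rule transI) (auto intro: equivD(5)[OF assms(1)])
qed

lemma equiv_restrict:
  assumes "equiv X \<alpha>" "Y \<subseteq> X"
  shows "equiv Y (\<alpha> \<inter> Y \<times> Y)"
proof (rule equivI)
  show "\<alpha> \<inter> Y \<times> Y \<subseteq> Y \<times> Y" by auto
  show "refl_on Y (\<alpha> \<inter> Y \<times> Y)"
    using assms(2) equivD(3)[OF assms(1)] by (auto simp: refl_on_def)
  show "sym (\<alpha> \<inter> Y \<times> Y)"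
    by (rule symI) (auto intro: equivD(4)[OF assms(1)])
  show "trans (\<alpha> \<inter> Y \<times> Y)"
    by (rule transI) (auto intro: equivD(5)[OF assms(1)])
qed

text \<open>This lets permutability descend to a smaller set: a path through the extended relations that
  starts and ends in \<open>Y\<close> takes an identity step only where \<open>\<alpha>\<close> or \<open>\<beta>\<close> is reflexive anyway.\<close>

lemma commute_if_extensions_commute:
  assumes "equiv Y \<alpha>" "equiv Y \<beta>"
    and "(\<alpha> \<union> Id_on X) O (\<beta> \<union> Id_on X) = (\<beta> \<union> Id_on X) O (\<alpha> \<union> Id_on X)"
  shows "\<alpha> O \<beta> \<subseteq> \<beta> O \<alpha>"
proof
  fix p assume "p \<in> \<alpha> O \<beta>"
  then obtain x y w where p: "p = (x, w)" and xy: "(x, y) \<in> \<alpha>" and yw: "(y, w) \<in> \<beta>"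
    by auto
  have Y: "x \<in> Y" "w \<in> Y"
    using equivD(1)[OF assms(1) xy] equivD(2)[OF assms(2) yw] by auto
  have "(x, w) \<in> (\<beta> \<union> Id_on X) O (\<alpha> \<union> Id_on X)"
    using xy yw assms(3) by blast
  then show "p \<in> \<beta> O \<alpha>"
    using Y equivD(3)[OF assms(1)] equivD(3)[OF assms(2)] p by auto
qed

lemma gset_congruence_permutableI:
  assumes "\<And>\<alpha> \<beta> x y w. \<lbrakk>gset_congruence G X act \<alpha>; gset_congruence G X act \<beta>;
      (x, y) \<in> \<alpha>; (y, w) \<in> \<beta>\<rbrakk> \<Longrightarrow> (x, w) \<in> \<beta> O \<alpha>"
  shows "gset_congruence_permutable G X act"
  unfolding gset_congruence_permutable_def
proof (intro allI impI, elim conjE, rule equalityI)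
  fix \<alpha> \<beta> assume "gset_congruence G X act \<alpha>" "gset_congruence G X act \<beta>"
  then show "\<alpha> O \<beta> \<subseteq> \<beta> O \<alpha>" "\<beta> O \<alpha> \<subseteq> \<alpha> O \<beta>"
    using assms by (blast)+
qed

lemma gset_congruence_permutableD:
  assumes "gset_congruence_permutable G X act" "gset_congruence G X act \<alpha>"
    "gset_congruence G X act \<beta>" "(x, y) \<in> \<alpha>" "(y, w) \<in> \<beta>"
  obtains v where "(x, v) \<in> \<beta>" "(v, w) \<in> \<alpha>"
  using assms unfolding gset_congruence_permutable_def by blast

lemma semigroup_congruence_permutableI:
  assumes "\<And>\<alpha> \<beta> x y w. \<lbrakk>semigroup_congruence S f \<alpha>; semigroup_congruence S f \<beta>;
      (x, y) \<in> \<alpha>; (y, w) \<in> \<beta>\<rbrakk> \<Longrightarrow> (x, w) \<in> \<beta> O \<alpha>"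
  shows "semigroup_congruence_permutable S f"
  unfolding semigroup_congruence_permutable_def
proof (intro allI impI, elim conjE, rule equalityI)
  fix \<alpha> \<beta> assume "semigroup_congruence S f \<alpha>" "semigroup_congruence S f \<beta>"
  then show "\<alpha> O \<beta> \<subseteq> \<beta> O \<alpha>" "\<beta> O \<alpha> \<subseteq> \<alpha> O \<beta>"
    using assms by (blast)+
qed

lemma semigroup_congruence_permutable_cong:
  assumes "\<And>s t. \<lbrakk>s \<in> S; t \<in> S\<rbrakk> \<Longrightarrow> f s t = g s t"
  shows "semigroup_congruence_permutable S f \<longleftrightarrow> semigroup_congruence_permutable S g"
proof -
  have "semigroup_congruence S f \<alpha> \<longleftrightarrow> semigroup_congruence S g \<alpha>" for \<alpha>
  proof (cases "equiv S \<alpha>")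
    case True
    have "(f s a, f s b) = (g s a, g s b) \<and> (f a s, f b s) = (g a s, g b s)"
      if "(a, b) \<in> \<alpha>" "s \<in> S" for a b s
      using that equivD(1,2)[OF True] by (simp add: assms)
    then show ?thesis
      by (auto simp: semigroup_congruence_def)
  qed (simp add: semigroup_congruence_def)
  then show ?thesis
    by (simp add: semigroup_congruence_permutable_def)
qed


section \<open>Congruences and invariant subsets of a right G-set\<close>

lemma gset_congruence_extend:
  assumes "right_gset G X act" "gset_congruence G Y act \<alpha>" "Y \<subseteq> X"
  shows "gset_congruence G X act (\<alpha> \<union> Id_on X)"
  using assms(2) equiv_extend_Id_on[OF _ assms(3)] right_gset.act_closed[OF assms(1)]
  by (auto simp: gset_congruence_def)

lemma gset_congruence_restrict:
  assumes "right_gset G Y act" "gset_congruence G X act \<alpha>" "Y \<subseteq> X"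
  shows "gset_congruence G Y act (\<alpha> \<inter> Y \<times> Y)"
  using assms(2) equiv_restrict[OF _ assms(3)] right_gset.act_closed[OF assms(1)]
  by (auto simp: gset_congruence_def)

lemma gset_congruence_collapse:
  assumes "right_gset G X act" "C \<subseteq> X"
    and "\<And>x g. \<lbrakk>x \<in> C; g \<in> carrier G\<rbrakk> \<Longrightarrow> act x g \<in> C"
  shows "gset_congruence G X act (C \<times> C \<union> Id_on X)"
proof -
  have "equiv C (C \<times> C)"
    by (auto intro!: equivI simp: refl_on_def sym_def trans_def)
  then have "gset_congruence G C act (C \<times> C)"
    by (auto simp: gset_congruence_def assms(3))
  then show ?thesis
    using gset_congruence_extend assms(1,2) by blast
qed

lemma gset_congruence_permutable_subset:
  assumes "right_gset G X act" "gset_congruence_permutable G X act" "Y \<subseteq> X"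
  shows "gset_congruence_permutable G Y act"
proof (rule gset_congruence_permutableI)
  fix \<alpha> \<beta> x y w
  assume cong: "gset_congruence G Y act \<alpha>" "gset_congruence G Y act \<beta>"
    and "(x, y) \<in> \<alpha>" "(y, w) \<in> \<beta>"
  moreover have "\<alpha> O \<beta> \<subseteq> \<beta> O \<alpha>"
  proof (rule commute_if_extensions_commute)
    show "equiv Y \<alpha>" "equiv Y \<beta>"
      using cong by (auto simp: gset_congruence_def)
    show "(\<alpha> \<union> Id_on X) O (\<beta> \<union> Id_on X) = (\<beta> \<union> Id_on X) O (\<alpha> \<union> Id_on X)"
      using gset_congruence_extend[OF assms(1) cong(1) assms(3)]
        gset_congruence_extend[OF assms(1) cong(2) assms(3)] assms(2)
      unfolding gset_congruence_permutable_def by blast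
  qed
  ultimately show "(x, w) \<in> \<beta> O \<alpha>"
    by blast
qed


section \<open>Orbits\<close>

lemma gset_orbitD:
  assumes "gset_orbit G X act A"
  shows "A \<subseteq> X" "right_gset G A act" "A \<noteq> {}"
    "\<lbrakk>x \<in> A; g \<in> carrier G\<rbrakk> \<Longrightarrow> act x g \<in> A"
proof -
  show "A \<subseteq> X" and A: "right_gset G A act"
    using assms by (simp_all add: gset_orbit_def)
  show "A \<noteq> {}" "\<lbrakk>x \<in> A; g \<in> carrier G\<rbrakk> \<Longrightarrow> act x g \<in> A"
    using right_gset.nonempty[OF A] right_gset.act_closed[OF A] by simp_all
qed

lemma gset_orbit_image:
  assumes "gset_orbit G X act A" "x \<in> A"
  shows "A = act x ` carrier G"
proof
  show "A \<subseteq> act x ` carrier G"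
  proof
    fix y assume "y \<in> A"
    then obtain g where "g \<in> carrier G" "act x g = y"
      using assms unfolding gset_orbit_def gset_transitive_def by blast
    then show "y \<in> act x ` carrier G"
      by blast
  qed
  show "act x ` carrier G \<subseteq> A"
    using gset_orbitD(4)[OF assms(1,2)] by blast
qed

lemma gset_orbit_eq:
  assumes "gset_orbit G X act A" "gset_orbit G X act B" "x \<in> A" "x \<in> B"
  shows "A = B"
  using gset_orbit_image[OF assms(1,3)] gset_orbit_image[OF assms(2,4)] by simp

lemma ex_gset_orbit:
  assumes "right_gset G X act" "x \<in> X"
  shows "\<exists>A. gset_orbit G X act A \<and> x \<in> A"
proof -
  interpret right_gset G X act by fact
  let ?A = "act x ` carrier G"
  have sub: "?A \<subseteq> X"
    using assms(2) act_closed by blast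
  have "right_gset G ?A act"
  proof
    show "act x ` carrier G \<noteq> {}" by blast
    show "act y g \<in> ?A" if "y \<in> ?A" "g \<in> carrier G" for y g
      using that assms(2) by (auto simp: act_mult)
    show "act y \<one>\<^bsub>G\<^esub> = y" if "y \<in> ?A" for y
      using that sub act_one by blast
    show "act (act y g) h = act y (g \<otimes>\<^bsub>G\<^esub> h)"
      if "y \<in> ?A" "g \<in> carrier G" "h \<in> carrier G" for y g h
      using that sub act_mult by blast
  qed
  moreover have "gset_transitive G ?A act"
    unfolding gset_transitive_def
  proof clarify
    fix g h assume gh: "g \<in> carrier G" "h \<in> carrier G"
    then have "act (act x g) (inv\<^bsub>G\<^esub> g \<otimes>\<^bsub>G\<^esub> h) = act x h"
      using assms(2) by (simp add: act_mult m_assoc[symmetric])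
    then show "\<exists>k\<in>carrier G. act (act x g) k = act x h"
      using gh by blast
  qed
  moreover have "x \<in> ?A"
    using act_one[OF assms(2)] by force
  ultimately show ?thesis
    using sub unfolding gset_orbit_def by blast
qed

lemma at_most_two_iff:
  "finite \<A> \<and> card \<A> \<le> 2 \<longleftrightarrow> (\<forall>A\<in>\<A>. \<forall>B\<in>\<A>. \<forall>C\<in>\<A>. A = B \<or> B = C \<or> A = C)"
proof (intro iffI)
  assume fin: "finite \<A> \<and> card \<A> \<le> 2"
  show "\<forall>A\<in>\<A>. \<forall>B\<in>\<A>. \<forall>C\<in>\<A>. A = B \<or> B = C \<or> A = C"
  proof (intro ballI, rule ccontr)
    fix A B C assume "A \<in> \<A>" "B \<in> \<A>" "C \<in> \<A>" "\<not> (A = B \<or> B = C \<or> A = C)"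
    then have "card {A, B, C} = 3" "{A, B, C} \<subseteq> \<A>" by auto
    then show False
      using fin card_mono[of \<A> "{A, B, C}"] by simp
  qed
next
  assume *: "\<forall>A\<in>\<A>. \<forall>B\<in>\<A>. \<forall>C\<in>\<A>. A = B \<or> B = C \<or> A = C"
  have "\<exists>A B. \<A> \<subseteq> {A, B}"
    using * by (cases "\<exists>A\<in>\<A>. \<exists>B\<in>\<A>. A \<noteq> B") blast+
  then obtain A B where "\<A> \<subseteq> {A, B}" by blast
  moreover have "card {A, B} \<le> 2"
    by (simp add: card_insert_if)
  ultimately show "finite \<A> \<and> card \<A> \<le> 2"
    using finite_subset[of \<A> "{A, B}"] card_mono[of "{A, B}" \<A>] by auto
qed

text \<open>As \<open>G\<close>, \<open>X\<close> and \<open>0\<close> are disjoint, an orbit is recovered from its subsemigroup by intersecting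
  with \<open>X\<close>; so it makes no difference which of the two are counted.\<close>

lemma orbit_subsemigroups_at_most_two_iff:
  assumes "carrier G \<inter> X = {}" "z \<notin> carrier G \<union> X"
  shows "finite (orbit_subsemigroups G X act z) \<and> card (orbit_subsemigroups G X act z) \<le> 2 \<longleftrightarrow>
    (\<forall>A B C. gset_orbit G X act A \<and> gset_orbit G X act B \<and> gset_orbit G X act C \<longrightarrow>
      A = B \<or> B = C \<or> A = C)"
proof -
  have eq: "orbit_subsemigroups G X act z = (\<lambda>A. gx0_carrier G A z) ` {A. gset_orbit G X act A}"
    by (auto simp: orbit_subsemigroups_def)
  have "inj_on (\<lambda>A. gx0_carrier G A z) {A. gset_orbit G X act A}"
  proof (rule inj_on_inverseI)
    fix A assume "A \<in> {A. gset_orbit G X act A}"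
    then show "gx0_carrier G A z \<inter> X = A"
      using assms gset_orbitD(1)[of G X act A] by (auto simp: gx0_carrier_def)
  qed
  then have "finite (orbit_subsemigroups G X act z) = finite {A. gset_orbit G X act A}"
    "card (orbit_subsemigroups G X act z) = card {A. gset_orbit G X act A}"
    unfolding eq by (simp_all add: finite_image_iff card_image)
  then show ?thesis
    by (simp add: at_most_two_iff Ball_def) blast
qed


section \<open>Permutability of a G-set in terms of its orbits\<close>

text \<open>A link from \<open>a0\<close> to \<open>b0\<close>, preceded by the collapse of \<open>A\<close>, leads from every \<open>a\<close> in \<open>A\<close> to \<open>b0\<close>.
  In the opposite order the collapse has to come last, where it cannot move to \<open>b0\<close> from anywhere
  else; so the congruence itself links \<open>a\<close> to \<open>b0\<close>.\<close>

lemma link_spreads_over_invariant_subset: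
  assumes "right_gset G X act" "gset_congruence_permutable G X act" "gset_congruence G X act \<alpha>"
    and "A \<subseteq> X" "\<And>x g. \<lbrakk>x \<in> A; g \<in> carrier G\<rbrakk> \<Longrightarrow> act x g \<in> A"
    and "a0 \<in> A" "b0 \<notin> A" "(a0, b0) \<in> \<alpha>" "a \<in> A"
  shows "(a, b0) \<in> \<alpha>"
proof -
  have "gset_congruence G X act (A \<times> A \<union> Id_on X)"
    using assms(1,4,5) by (rule gset_congruence_collapse)
  moreover have "(a, a0) \<in> A \<times> A \<union> Id_on X"
    using assms by blast
  ultimately obtain v where "(a, v) \<in> \<alpha>" "(v, b0) \<in> A \<times> A \<union> Id_on X"
    using gset_congruence_permutableD[OF assms(2) _ assms(3) _ assms(8)] by metis
  then show ?thesis
    using assms(7) by auto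
qed

lemma permutable_imp_segregated:
  assumes X: "right_gset G X act" and perm: "gset_congruence_permutable G X act"
  shows "gset_segregated G X act"
  unfolding gset_segregated_def
proof (intro allI impI, elim conjE bexE)
  fix \<alpha> A B a0 b0
  assume \<alpha>: "gset_congruence G X act \<alpha>"
    and A: "gset_orbit G X act A" and B: "gset_orbit G X act B" and "A \<noteq> B"
    and ab: "a0 \<in> A" "b0 \<in> B" "(a0, b0) \<in> \<alpha>"
  note E = equivD[of X \<alpha>]
  have eq: "equiv X \<alpha>"
    using \<alpha> by (simp add: gset_congruence_def)
  have notin: "b0 \<notin> A" "a0 \<notin> B"
    using gset_orbit_eq[OF A B] \<open>A \<noteq> B\<close> ab by blast+
  have "(a, b0) \<in> \<alpha>" if "a \<in> A" for a
    by (rule link_spreads_over_invariant_subset[OF X perm \<alpha> gset_orbitD(1,4)[OF A]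
          ab(1) notin(1) ab(3) that])
  moreover have "(b, a0) \<in> \<alpha>" if "b \<in> B" for b
    by (rule link_spreads_over_invariant_subset[OF X perm \<alpha> gset_orbitD(1,4)[OF B]
          ab(2) notin(2) E(4)[OF eq ab(3)] that])
  ultimately have "(c, b0) \<in> \<alpha>" if "c \<in> A \<union> B" for c
    using that ab(3) E(5)[OF eq] by blast
  then show "\<forall>a\<in>A \<union> B. \<forall>b\<in>A \<union> B. (a, b) \<in> \<alpha>"
    using E(4,5)[OF eq] by blast
qed

text \<open>The witness of non-commutation is a pair of collapses that overlap in the middle orbit: from \<open>A\<close>,
  the collapse of \<open>B \<union> C\<close> cannot move, and that of \<open>A \<union> B\<close> cannot reach \<open>C\<close>.\<close>

lemma permutable_imp_at_most_two_orbits: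
  assumes X: "right_gset G X act" and perm: "gset_congruence_permutable G X act"
    and A: "gset_orbit G X act A" and B: "gset_orbit G X act B" and C: "gset_orbit G X act C"
  shows "A = B \<or> B = C \<or> A = C"
proof (rule ccontr)
  assume distinct: "\<not> (A = B \<or> B = C \<or> A = C)"
  obtain a b c where abc: "a \<in> A" "b \<in> B" "c \<in> C"
    using gset_orbitD(3)[OF A] gset_orbitD(3)[OF B] gset_orbitD(3)[OF C] by blast
  have notin: "a \<notin> B \<union> C" "c \<notin> A \<union> B"
    using distinct abc gset_orbit_eq[OF A B] gset_orbit_eq[OF A C] gset_orbit_eq[OF B C] by blast+
  let ?\<alpha> = "(A \<union> B) \<times> (A \<union> B) \<union> Id_on X" and ?\<beta> = "(B \<union> C) \<times> (B \<union> C) \<union> Id_on X"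
  have "gset_congruence G X act ?\<alpha>" "gset_congruence G X act ?\<beta>"
    using gset_orbitD(1,4)[OF A] gset_orbitD(1,4)[OF B] gset_orbitD(1,4)[OF C]
    by (auto intro!: gset_congruence_collapse[OF X])
  moreover have "(a, b) \<in> ?\<alpha>" "(b, c) \<in> ?\<beta>"
    using abc by blast+
  ultimately obtain v where "(a, v) \<in> ?\<beta>" "(v, c) \<in> ?\<alpha>"
    by (rule gset_congruence_permutableD[OF perm])
  then have "a = c"
    using notin by auto
  then show False
    using abc notin by blast
qed

lemma permutable_if_segregated:
  assumes X: "right_gset G X act" and seg: "gset_segregated G X act"
    and two: "\<And>A B C. \<lbrakk>gset_orbit G X act A; gset_orbit G X act B; gset_orbit G X act C\<rbrakk>
      \<Longrightarrow> A = B \<or> B = C \<or> A = C"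
    and perm: "\<And>A. gset_orbit G X act A \<Longrightarrow> gset_congruence_permutable G A act"
  shows "gset_congruence_permutable G X act"
proof (rule gset_congruence_permutableI)
  \<comment> \<open>Two different orbits exhaust \<open>X\<close>, so a link between them makes a congruence the full relation.\<close>
  have full: "(u, v) \<in> \<gamma>"
    if \<gamma>: "gset_congruence G X act \<gamma>" and A: "gset_orbit G X act A" and B: "gset_orbit G X act B"
      and "A \<noteq> B" "a \<in> A" "b \<in> B" "(a, b) \<in> \<gamma>" "u \<in> X" "v \<in> X" for \<gamma> A B a b u v
  proof -
    have "x \<in> A \<union> B" if "x \<in> X" for x
      using ex_gset_orbit[OF X that] two[OF A B] \<open>A \<noteq> B\<close> by blast
    moreover have "\<forall>u\<in>A \<union> B. \<forall>v\<in>A \<union> B. (u, v) \<in> \<gamma>"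
      using seg \<gamma> A B \<open>A \<noteq> B\<close> \<open>a \<in> A\<close> \<open>b \<in> B\<close> \<open>(a, b) \<in> \<gamma>\<close>
      unfolding gset_segregated_def by blast
    ultimately show ?thesis
      using \<open>u \<in> X\<close> \<open>v \<in> X\<close> by blast
  qed
  fix \<alpha> \<beta> x y w
  assume \<alpha>: "gset_congruence G X act \<alpha>" and \<beta>: "gset_congruence G X act \<beta>"
    and xy: "(x, y) \<in> \<alpha>" and yw: "(y, w) \<in> \<beta>"
  have eq: "equiv X \<alpha>" "equiv X \<beta>"
    using \<alpha> \<beta> by (simp_all add: gset_congruence_def)
  have mem: "x \<in> X" "y \<in> X" "w \<in> X"
    using equivD(1,2)[OF eq(1) xy] equivD(2)[OF eq(2) yw] by auto
  obtain A B C where A: "gset_orbit G X act A" "x \<in> A" and B: "gset_orbit G X act B" "y \<in> B"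
    and C: "gset_orbit G X act C" "w \<in> C"
    using ex_gset_orbit[OF X mem(1)] ex_gset_orbit[OF X mem(2)] ex_gset_orbit[OF X mem(3)] by blast
  consider "A \<noteq> B" | "B \<noteq> C" | "A = B" "B = C" by blast
  then show "(x, w) \<in> \<beta> O \<alpha>"
  proof cases
    case 1
    then have "(x, w) \<in> \<alpha>"
      using full[OF \<alpha> A(1) B(1) _ A(2) B(2) xy] mem by blast
    then show ?thesis
      using equivD(3)[OF eq(2)] mem by blast
  next
    case 2
    then have "(x, w) \<in> \<beta>"
      using full[OF \<beta> B(1) C(1) _ B(2) C(2) yw] mem by blast
    then show ?thesis
      using equivD(3)[OF eq(1)] mem by blast
  next
    case 3
    let ?\<alpha> = "\<alpha> \<inter> B \<times> B" and ?\<beta> = "\<beta> \<inter> B \<times> B"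
    have "gset_congruence G B act ?\<alpha>" "gset_congruence G B act ?\<beta>"
      using gset_congruence_restrict gset_orbitD(1,2)[OF B(1)] \<alpha> \<beta> by blast+
    moreover have "(x, y) \<in> ?\<alpha>" "(y, w) \<in> ?\<beta>"
      using 3 A B C xy yw by auto
    ultimately obtain v where "(x, v) \<in> ?\<beta>" "(v, w) \<in> ?\<alpha>"
      by (rule gset_congruence_permutableD[OF perm[OF B(1)]])
    then show ?thesis
      by blast
  qed
qed


section \<open>The semigroup of a transitive G-set\<close>

lemma gset_congruence_if_semigroup_congruence:
  assumes "right_gset G A act" "carrier G \<inter> A = {}"
    and "semigroup_congruence (gx0_carrier G A z) (gx0_mult G A act z) \<alpha>"
  shows "gset_congruence G A act (\<alpha> \<inter> A \<times> A)"
proof -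
  have "equiv A (\<alpha> \<inter> A \<times> A)"
    using assms(3) by (intro equiv_restrict) (auto simp: semigroup_congruence_def gx0_carrier_def)
  moreover have "(act a g, act b g) \<in> \<alpha> \<inter> A \<times> A"
    if "(a, b) \<in> \<alpha> \<inter> A \<times> A" "g \<in> carrier G" for a b g
  proof -
    have "g \<in> gx0_carrier G A z"
      using that by (simp add: gx0_carrier_def)
    then have "(gx0_mult G A act z a g, gx0_mult G A act z b g) \<in> \<alpha>"
      using assms(3) that unfolding semigroup_congruence_def by blast
    moreover have "a \<notin> carrier G" "b \<notin> carrier G"
      using that assms(2) by blast+
    ultimately show ?thesis
      using that right_gset.act_closed[OF assms(1)] by (simp add: gx0_mult_def)
  qed
  ultimately show ?thesis
    by (auto simp: gset_congruence_def)
qed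

text \<open>Left multiplication sends all of \<open>A\<close> to \<open>0\<close> and so imposes no condition on pairs in \<open>A\<close>.\<close>

lemma semigroup_congruence_if_gset_congruence:
  assumes "right_gset G A act" "carrier G \<inter> A = {}" "z \<notin> carrier G \<union> A"
    and "gset_congruence G A act \<alpha>"
  shows "semigroup_congruence (gx0_carrier G A z) (gx0_mult G A act z)
    (\<alpha> \<union> Id_on (gx0_carrier G A z))"
proof -
  let ?S = "gx0_carrier G A z" and ?f = "gx0_mult G A act z"
  interpret semigroup_on ?S ?f
    using assms(1-3) by (rule semigroup_on_gx0)
  have eq: "equiv A \<alpha>"
    using assms(4) by (simp add: gset_congruence_def)
  have z: "z \<in> ?S"
    by (simp add: gx0_carrier_def)
  have "(?f s a, ?f s b) \<in> \<alpha> \<union> Id_on ?S \<and> (?f a s, ?f b s) \<in> \<alpha> \<union> Id_on ?S"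
    if "(a, b) \<in> \<alpha> \<union> Id_on ?S" "s \<in> ?S" for a b s
  proof (cases "(a, b) \<in> \<alpha>")
    case True
    then have ab: "a \<in> A" "b \<in> A" "a \<notin> carrier G" "b \<notin> carrier G"
      using equivD(1,2)[OF eq] assms(2) by blast+
    show ?thesis
    proof (cases "s \<in> carrier G")
      case s: True
      then have "(act a s, act b s) \<in> \<alpha>"
        using True assms(4) by (auto simp: gset_congruence_def)
      then show ?thesis
        using ab s z by (simp add: gx0_mult_def Id_on_iff)
    qed (use ab z in \<open>simp add: gx0_mult_def Id_on_iff\<close>)
  next
    case False
    then show ?thesis
      using that closed by (auto simp: Id_on_iff)
  qed
  moreover have "equiv ?S (\<alpha> \<union> Id_on ?S)"
    using eq by (rule equiv_extend_Id_on) (auto simp: gx0_carrier_def)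
  ultimately show ?thesis
    unfolding semigroup_congruence_def by blast
qed

text \<open>If \<open>g\<close> in \<open>G\<close> is congruent to some \<open>t\<close> outside \<open>G\<close>, cancelling \<open>g\<close> on the left turns this into
  a link from the identity of \<open>G\<close>, a right identity of the semigroup, to \<open>0\<close>.\<close>

lemma semigroup_congruence_full_if_joins_group:
  assumes "right_gset G A act" "carrier G \<inter> A = {}" "z \<notin> carrier G \<union> A"
    and cong: "semigroup_congruence (gx0_carrier G A z) (gx0_mult G A act z) \<alpha>"
    and "(g, t) \<in> \<alpha>" "g \<in> carrier G" "t \<notin> carrier G"
    and "u \<in> gx0_carrier G A z" "v \<in> gx0_carrier G A z"
  shows "(u, v) \<in> \<alpha>"
proof -
  let ?S = "gx0_carrier G A z" and ?f = "gx0_mult G A act z"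
  interpret right_gset G A act by fact
  note equ = cong[unfolded semigroup_congruence_def, THEN conjunct1]
  have left: "(?f s a, ?f s b) \<in> \<alpha>" if "(a, b) \<in> \<alpha>" "s \<in> ?S" for a b s
    using cong that unfolding semigroup_congruence_def by blast
  have "inv\<^bsub>G\<^esub> g \<in> ?S"
    using assms(6) by (simp add: gx0_carrier_def)
  from left[OF assms(5) this] have one: "(\<one>\<^bsub>G\<^esub>, z) \<in> \<alpha>"
    using assms(2,3,6,7) by (simp add: gx0_mult_def)
  have "(s, z) \<in> \<alpha>" if "s \<in> ?S" for s
  proof -
    have "?f s \<one>\<^bsub>G\<^esub> = s" "?f s z = z"
      using that assms(2,3) by (auto simp: gx0_carrier_def gx0_mult_def act_one)
    then show ?thesis
      using left[OF one that] by simp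
  qed
  from this[OF assms(8)] this[OF assms(9)] show ?thesis
    by (rule equivD(5)[OF equ _ equivD(4)[OF equ]])
qed

lemma semigroup_congruence_collapses_if_joins_zero:
  assumes "right_gset G A act" "gset_transitive G A act"
    and "carrier G \<inter> A = {}" "z \<notin> carrier G \<union> A"
    and cong: "semigroup_congruence (gx0_carrier G A z) (gx0_mult G A act z) \<alpha>"
    and "(x, z) \<in> \<alpha>" "x \<in> A" "u \<in> A \<union> {z}" "v \<in> A \<union> {z}"
  shows "(u, v) \<in> \<alpha>"
proof -
  let ?S = "gx0_carrier G A z" and ?f = "gx0_mult G A act z"
  note equ = cong[unfolded semigroup_congruence_def, THEN conjunct1]
  have "(y, z) \<in> \<alpha>" if "y \<in> A \<union> {z}" for y
  proof (cases "y = z")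
    case True
    then show ?thesis
      using equivD(3)[OF equ] by (simp add: gx0_carrier_def)
  next
    case False
    with that have "y \<in> A" by simp
    then obtain g where g: "g \<in> carrier G" "act x g = y"
      using assms(2,7) unfolding gset_transitive_def by blast
    then have "g \<in> ?S"
      by (simp add: gx0_carrier_def)
    then have "(?f x g, ?f z g) \<in> \<alpha>"
      using cong assms(6) unfolding semigroup_congruence_def by blast
    moreover have "x \<notin> carrier G"
      using assms(3,7) by blast
    ultimately show ?thesis
      using g assms(4,7) by (simp add: gx0_mult_def)
  qed
  from this[OF assms(8)] this[OF assms(9)] show ?thesis
    by (rule equivD(5)[OF equ _ equivD(4)[OF equ]])
qed

text \<open>On \<open>G\<close> the two congruences commute by the Malcev term \<open>s t\<^sup>-\<^sup>1 u\<close>; on \<open>A\<close> they commute by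
  assumption; in every other case one of them already relates the two ends.\<close>

lemma semigroup_permutable_if_gset_permutable:
  assumes A: "right_gset G A act" "gset_transitive G A act"
    and disj: "carrier G \<inter> A = {}" "z \<notin> carrier G \<union> A"
    and perm: "gset_congruence_permutable G A act"
  shows "semigroup_congruence_permutable (gx0_carrier G A z) (gx0_mult G A act z)"
proof (rule semigroup_congruence_permutableI)
  let ?S = "gx0_carrier G A z" and ?f = "gx0_mult G A act z"
  interpret right_gset G A act by fact
  fix \<alpha> \<beta> s t u
  assume \<alpha>: "semigroup_congruence ?S ?f \<alpha>" and \<beta>: "semigroup_congruence ?S ?f \<beta>"
    and st: "(s, t) \<in> \<alpha>" and tu: "(t, u) \<in> \<beta>"
  have eq: "equiv ?S \<alpha>" "equiv ?S \<beta>"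
    using \<alpha> \<beta> by (simp_all add: semigroup_congruence_def)
  note sym = equivD(4)[OF eq(1) st] equivD(4)[OF eq(2) tu]
  have mem: "s \<in> ?S" "t \<in> ?S" "u \<in> ?S"
    using equivD(1,2)[OF eq(1) st] equivD(2)[OF eq(2) tu] by auto
  have enough: "(s, u) \<in> \<beta> O \<alpha>" if "(s, u) \<in> \<alpha> \<or> (s, u) \<in> \<beta>"
    using that mem equivD(3)[OF eq(1)] equivD(3)[OF eq(2)] by blast
  note full = semigroup_congruence_full_if_joins_group[OF A(1) disj]
  note zero = semigroup_congruence_collapses_if_joins_zero[OF A disj]
  consider (join_\<alpha>) "s \<in> carrier G \<longleftrightarrow> t \<notin> carrier G"
    | (join_\<beta>) "t \<in> carrier G \<longleftrightarrow> u \<notin> carrier G"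
    | (group) "s \<in> carrier G" "t \<in> carrier G" "u \<in> carrier G"
    | (outside) "s \<in> A \<union> {z}" "t \<in> A \<union> {z}" "u \<in> A \<union> {z}"
    using mem by (auto simp: gx0_carrier_def)
  then show "(s, u) \<in> \<beta> O \<alpha>"
  proof cases
    case join_\<alpha>
    then have "(s, u) \<in> \<alpha>"
      using full[OF \<alpha> st _ _ mem(1,3)] full[OF \<alpha> sym(1) _ _ mem(1,3)] by blast
    then show ?thesis using enough by blast
  next
    case join_\<beta>
    then have "(s, u) \<in> \<beta>"
      using full[OF \<beta> tu _ _ mem(1,3)] full[OF \<beta> sym(2) _ _ mem(1,3)] by blast
    then show ?thesis using enough by blast
  next
    case group
    let ?v = "s \<otimes>\<^bsub>G\<^esub> inv\<^bsub>G\<^esub> t \<otimes>\<^bsub>G\<^esub> u"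
    have S: "s \<otimes>\<^bsub>G\<^esub> inv\<^bsub>G\<^esub> t \<in> ?S" "inv\<^bsub>G\<^esub> t \<otimes>\<^bsub>G\<^esub> u \<in> ?S"
      using group by (simp_all add: gx0_carrier_def)
    have "(?f (s \<otimes>\<^bsub>G\<^esub> inv\<^bsub>G\<^esub> t) t, ?f (s \<otimes>\<^bsub>G\<^esub> inv\<^bsub>G\<^esub> t) u) \<in> \<beta>"
      using \<beta> tu S unfolding semigroup_congruence_def by blast
    then have "(s, ?v) \<in> \<beta>"
      using group by (simp add: gx0_mult_def m_assoc)
    moreover have "(?f s (inv\<^bsub>G\<^esub> t \<otimes>\<^bsub>G\<^esub> u), ?f t (inv\<^bsub>G\<^esub> t \<otimes>\<^bsub>G\<^esub> u)) \<in> \<alpha>"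
      using \<alpha> st S unfolding semigroup_congruence_def by blast
    then have "(?v, u) \<in> \<alpha>"
      using group by (simp add: gx0_mult_def m_assoc[symmetric])
    ultimately show ?thesis by blast
  next
    case outside
    consider "s = t" | "t = u" | "s \<noteq> t" "s = z \<or> t = z" | "t \<noteq> u" "t = z \<or> u = z"
      | "s \<in> A" "t \<in> A" "u \<in> A"
      using outside by blast
    then show ?thesis
    proof cases
      case 1
      then show ?thesis using tu enough by blast
    next
      case 2
      then show ?thesis using st enough by blast
    next
      case 3
      then have "(s, u) \<in> \<alpha>"
        using zero[OF \<alpha> _ _ outside(1,3)] st sym(1) outside by blast
      then show ?thesis using enough by blast
    next
      case 4
      then have "(s, u) \<in> \<beta>"
        using zero[OF \<beta> _ _ outside(1,3)] tu sym(2) outside by blast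
      then show ?thesis using enough by blast
    next
      case 5
      let ?\<alpha> = "\<alpha> \<inter> A \<times> A" and ?\<beta> = "\<beta> \<inter> A \<times> A"
      have "gset_congruence G A act ?\<alpha>" "gset_congruence G A act ?\<beta>"
        using gset_congruence_if_semigroup_congruence[OF A(1) disj(1)] \<alpha> \<beta> by blast+
      moreover have "(s, t) \<in> ?\<alpha>" "(t, u) \<in> ?\<beta>"
        using 5 st tu by auto
      ultimately obtain v where "(s, v) \<in> ?\<beta>" "(v, u) \<in> ?\<alpha>"
        by (rule gset_congruence_permutableD[OF perm])
      then show ?thesis by blast
    qed
  qed
qed

lemma gset_permutable_if_semigroup_permutable:
  assumes A: "right_gset G A act"
    and disj: "carrier G \<inter> A = {}" "z \<notin> carrier G \<union> A"
    and perm: "semigroup_congruence_permutable (gx0_carrier G A z) (gx0_mult G A act z)"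
  shows "gset_congruence_permutable G A act"
proof (rule gset_congruence_permutableI)
  let ?I = "Id_on (gx0_carrier G A z)"
  fix \<alpha> \<beta> x y w
  assume cong: "gset_congruence G A act \<alpha>" "gset_congruence G A act \<beta>"
    and "(x, y) \<in> \<alpha>" "(y, w) \<in> \<beta>"
  moreover have "\<alpha> O \<beta> \<subseteq> \<beta> O \<alpha>"
  proof (rule commute_if_extensions_commute)
    show "equiv A \<alpha>" "equiv A \<beta>"
      using cong by (auto simp: gset_congruence_def)
    show "(\<alpha> \<union> ?I) O (\<beta> \<union> ?I) = (\<beta> \<union> ?I) O (\<alpha> \<union> ?I)"
      using perm semigroup_congruence_if_gset_congruence[OF A disj cong(1)]
        semigroup_congruence_if_gset_congruence[OF A disj cong(2)]
      unfolding semigroup_congruence_permutable_def by blast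
  qed
  ultimately show "(x, w) \<in> \<beta> O \<alpha>"
    by blast
qed

lemma semigroup_permutable_iff_gset_permutable:
  assumes "gset_orbit G X act A" "carrier G \<inter> X = {}" "z \<notin> carrier G \<union> X"
  shows "semigroup_congruence_permutable (gx0_carrier G A z) (gx0_mult G X act z) \<longleftrightarrow>
    gset_congruence_permutable G A act"
proof -
  have A: "right_gset G A act" "gset_transitive G A act" "A \<subseteq> X"
    using assms(1) by (simp_all add: gset_orbit_def)
  then have "carrier G \<inter> A = {}" "z \<notin> carrier G \<union> A"
    using assms(2,3) by blast+
  then have "semigroup_congruence_permutable (gx0_carrier G A z) (gx0_mult G A act z) \<longleftrightarrow>
      gset_congruence_permutable G A act"
    using semigroup_permutable_if_gset_permutable[OF A(1,2)]
      gset_permutable_if_semigroup_permutable[OF A(1)]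
    by (intro iffI)
  then show ?thesis
    using semigroup_congruence_permutable_cong[OF gx0_mult_orbit[OF assms]] by simp
qed


section \<open>The characterization\<close>

theorem theorem2:
  fixes G :: "('a, 'm) monoid_scheme" and X :: "'a set" and act :: "'a \<Rightarrow> 'a \<Rightarrow> 'a" and z :: 'a
  assumes "group G"
    and "right_gset G X act"
    and "carrier G \<inter> X = {}"
    and "z \<notin> carrier G \<union> X"
  shows "gset_congruence_permutable G X act \<longleftrightarrow>
    gx0_segregated G X act z \<and>
    finite (orbit_subsemigroups G X act z) \<and> card (orbit_subsemigroups G X act z) \<le> 2 \<and>
    (\<forall>T\<in>orbit_subsemigroups G X act z.
       semigroup_congruence_permutable T (gx0_mult G X act z))"
proof -
  have orbits: "(\<forall>T\<in>orbit_subsemigroups G X act z.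
      semigroup_congruence_permutable T (gx0_mult G X act z)) \<longleftrightarrow>
    (\<forall>A. gset_orbit G X act A \<longrightarrow> gset_congruence_permutable G A act)"
    using semigroup_permutable_iff_gset_permutable[OF _ assms(3,4)]
    by (auto simp: orbit_subsemigroups_def)
  note two = orbit_subsemigroups_at_most_two_iff[OF assms(3,4), of act]
  show ?thesis
  proof
    assume perm: "gset_congruence_permutable G X act"
    have "gset_congruence_permutable G A act" if "gset_orbit G X act A" for A
      using gset_congruence_permutable_subset[OF assms(2) perm gset_orbitD(1)[OF that]] .
    then show "gx0_segregated G X act z \<and>
        finite (orbit_subsemigroups G X act z) \<and> card (orbit_subsemigroups G X act z) \<le> 2 \<and>
        (\<forall>T\<in>orbit_subsemigroups G X act z.
          semigroup_congruence_permutable T (gx0_mult G X act z))"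
      using two orbits permutable_imp_segregated[OF assms(2) perm]
        permutable_imp_at_most_two_orbits[OF assms(2) perm]
      unfolding gx0_segregated_def by blast
  next
    assume rhs: "gx0_segregated G X act z \<and>
        finite (orbit_subsemigroups G X act z) \<and> card (orbit_subsemigroups G X act z) \<le> 2 \<and>
        (\<forall>T\<in>orbit_subsemigroups G X act z.
          semigroup_congruence_permutable T (gx0_mult G X act z))"
    show "gset_congruence_permutable G X act"
    proof (rule permutable_if_segregated[OF assms(2)])
      show "gset_segregated G X act"
        using rhs by (simp add: gx0_segregated_def)
      show "A = B \<or> B = C \<or> A = C"
        if "gset_orbit G X act A" "gset_orbit G X act B" "gset_orbit G X act C" for A B C
        using that rhs two by blast
      show "gset_congruence_permutable G A act" if "gset_orbit G X act A" for A
        using that rhs orbits by blast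
    qed
  qed
qed

end
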